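(* Let $K=12$ and $c=144$. For each sufficiently large positive integer $M$ (large enough that $\frac{c\log M}{M}\le 1$), let $\alpha_0,\ldots,\alpha_{K-1}\in\mathbb{C}$ be nonzero numbers such that $\alpha_k\alpha_{k'}^{-1}$ is not an $M$th root of unity for any distinct $k,k'\in\{0,\ldots,K-1\}$, and define the $M\times M$ diagonal matrices $D_k:=\operatorname{diag}\{\alpha_k^m\}_{m=0}^{M-1}$ and $E:=\operatorname{diag}\{e^{2\pi i m/M}\}_{m=0}^{M-1}$; let $\omega:=e^{2\pi i/3}$. Let $B\subseteq\mathbb{Z}_M$ be a random subset such that the entries of the indicator function $\mathbf{1}_B$ are independent, identically distributed Bernoulli random variables with mean $\frac{c\log M}{M}$, and take $A:=(B\cup(-B))\setminus\{0\}$. Consider the collection of masks $$\mathcal{D}:=\{D_k\}_{0\le k\le K-1}\ \cup\ \{D_k+\omega^rE^aD_{k'}\ :\ 0\le k\le K-1,\ 0\le k'\le k,\ r\in\{0,1,2\},\ a\in A\}.$$ Then with high probability, $\mathcal{D}$ consists of at most $2\cdot10^5\cdot\log M$ masks and lends injective intensity measurements; that is, for all $x,y\in\mathbb{C}^M$, if $|\langle x,Df_m\rangle|^2=|\langle y,Df_m\rangle|^2$ for all $D\in\mathcal{D}$ and all $m\in\mathbb{Z}_M$, then $y=\theta x$ for some $\theta\in\mathbb{C}$ with $|\theta|=1$.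
   Context: $\mathbb{Z}_M$ denotes the integers modulo $M$, and vectors in $\mathbb{C}^M$ are indexed by $\mathbb{Z}_M=\{0,\ldots,M-1\}$. $f_m\in\mathbb{C}^M$ denotes the complex sinusoid with entries $f_m(m')=\frac{1}{M}e^{2\pi i m m'/M}$, $m'\in\mathbb{Z}_M$. The inner product is $\langle x,y\rangle=\sum_{m'}x(m')\overline{y(m')}$. A mask is a diagonal $M\times M$ complex matrix (a multiplication operator on $\mathbb{C}^M$). $-B=\{-b:b\in B\}$, with negation modulo $M$. $\log$ is the natural logarithm. "With high probability" means with probability tending to $1$ as $M\to\infty$. *)

theory Defs
  imports "HOL-Probability.Product_PMF" "Jordan_Normal_Form.Matrix"
begin

text \<open>Elements of the integers modulo \<open>M\<close> are represented by their residues in \<open>{0..<M}\<close>, and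
  masks are \<open>M \<times> M\<close> matrices over the complex numbers.\<close>

definition sinusoid :: "nat \<Rightarrow> nat \<Rightarrow> complex Matrix.vec" where
  "sinusoid M m = Matrix.vec M (\<lambda>m'. 1 / of_nat M * cis (2 * pi * real m * real m' / real M))"

definition power_mask :: "nat \<Rightarrow> complex \<Rightarrow> complex Matrix.mat" where
  "power_mask M z = mat_diag M (\<lambda>m. z ^ m)"

definition modulation :: "nat \<Rightarrow> complex Matrix.mat" where
  "modulation M = mat_diag M (\<lambda>m. cis (2 * pi * real m / real M))"

definition neg_residues :: "nat \<Rightarrow> nat set \<Rightarrow> nat set" where
  "neg_residues M B = (\<lambda>b. nat ((- int b) mod int M)) ` B"

definition connection_set :: "nat \<Rightarrow> nat set \<Rightarrow> nat set" where
  "connection_set M B = (B \<union> neg_residues M B) - {0}"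

definition masks :: "nat \<Rightarrow> nat \<Rightarrow> (nat \<Rightarrow> complex) \<Rightarrow> nat set \<Rightarrow> complex Matrix.mat set" where
  "masks M K \<alpha> A =
     {power_mask M (\<alpha> k) | k. k < K} \<union>
     {power_mask M (\<alpha> k)
        + cis (2 * pi / 3) ^ r \<cdot>\<^sub>m (modulation M ^\<^sub>m a * power_mask M (\<alpha> k'))
      | k k' r a. k < K \<and> k' \<le> k \<and> r \<in> {0, 1, 2} \<and> a \<in> A}"

definition intensity :: "complex Matrix.vec \<Rightarrow> complex Matrix.vec \<Rightarrow> real" where
  "intensity x v = (cmod (x \<bullet>c v))\<^sup>2"

definition injective_intensities :: "nat \<Rightarrow> complex Matrix.mat set \<Rightarrow> bool" where
  "injective_intensities M \<D> \<longleftrightarrow>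
     (\<forall>x\<in>carrier_vec M. \<forall>y\<in>carrier_vec M.
        (\<forall>D\<in>\<D>. \<forall>m<M. intensity x (D *\<^sub>v sinusoid M m) = intensity y (D *\<^sub>v sinusoid M m)) \<longrightarrow>
        (\<exists>\<theta>. cmod \<theta> = 1 \<and> y = \<theta> \<cdot>\<^sub>v x))"

text \<open>The law of a random subset of \<open>{0..<M}\<close> whose indicator has independent Bernoulli entries
  with mean \<open>p\<close>. For \<open>p\<close> outside the unit interval, \<^const>\<open>bernoulli_pmf\<close> truncates \<open>p\<close>.\<close>

definition random_subset :: "nat \<Rightarrow> real \<Rightarrow> nat set pmf" where
  "random_subset M p =
     map_pmf (\<lambda>h. {b. h b}) (Pi_pmf {..<M} False (\<lambda>_. bernoulli_pmf p))"

end

theory Submission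
  imports Defs "HOL-Computational_Algebra.Polynomial" "HOL-Real_Asymp.Real_Asymp"
begin

text \<open>Up to the factor \<open>1 / M\<close>, the inner product of \<open>x\<close> with the \<open>m\<close>-th sinusoid masked by
  \<open>D\<^sub>k\<close> is the value at the node \<open>cnj (\<alpha>\<^sub>k) exp (- 2 \<pi> i m / M)\<close> of the polynomial with coefficient
  vector \<open>x\<close>. The \<open>12 M\<close> nodes are distinct, so \<open>x \<noteq> 0\<close> vanishes at fewer than \<open>M\<close> of them, and a
  vector is determined by its values at any \<open>M\<close> nodes. By polarization, the masks indexed by \<open>A\<close>
  show that the ratio of the values of \<open>y\<close> and \<open>x\<close> agrees at any two nonzero vertices \<open>(k, m)\<close> and
  \<open>(k', m + a)\<close>. If no ratio were attained at \<open>M\<close> vertices, then a union of ratio classes and its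
  complement would project to two subsets of density at least \<open>5 / 12\<close> in the cyclic group with no edge
  between them. The expander mixing lemma excludes this if the nontrivial character sums of \<open>B\<close>
  are bounded by \<open>\<lambda>\<close> with \<open>\<lambda> / |B| < 5 / 12\<close>, which holds with high probability by Chernoff bounds
  and a union bound over the \<open>M\<close> characters.\<close>

subsection \<open>Tail bounds for random subsets\<close>

text \<open>For \<open>x = - y\<close> with \<open>y > 0\<close> the claim amounts to
  \<open>(1 - y + y^2) * exp y\<close> being at least 1, which follows from the quadratic Taylor
  lower bound for \<open>exp y\<close>.\<close>

lemma exp_le_quadratic:
  fixes x :: real
  assumes "\<bar>x\<bar> \<le> 1"
  shows "exp x \<le> 1 + x + x\<^sup>2"
proof (cases "0 \<le> x")
  case True
  then show ?thesis
    using assms exp_bound[of x] by simp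
next
  case False
  define y where "y = - x"
  have y: "0 < y" "y \<le> 1"
    using False assms by (auto simp: y_def)
  have "1 \<le> (1 - y + y\<^sup>2) * (1 + y + y\<^sup>2 / 2)"
  proof -
    have "(1 - y + y\<^sup>2) * (1 + y + y\<^sup>2 / 2) = 1 + (y\<^sup>2 + y ^ 3 + y ^ 4) / 2"
      by (simp add: field_simps power2_eq_square power3_eq_cube power4_eq_xxxx)
    then show ?thesis using y by simp
  qed
  \<comment> \<open>The first factor is positive, being \<open>(y - 1/2)^2 + 3/4\<close>.\<close>
  also have "\<dots> \<le> (1 - y + y\<^sup>2) * exp y"
    using y exp_lower_Taylor_quadratic[of y] sum_power2_ge_zero[of "y - 1/2" 0]
    by (intro mult_left_mono) (auto simp: power2_eq_square algebra_simps)
  finally have "exp (- y) \<le> 1 - y + y\<^sup>2"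
    by (simp add: exp_minus field_simps)
  then show ?thesis by (simp add: y_def)
qed

lemma random_subset_subset: "B \<in> set_pmf (random_subset M p) \<Longrightarrow> B \<subseteq> {..<M}"
  using set_Pi_pmf_subset[of "{..<M}" False "\<lambda>_. bernoulli_pmf p"]
  by (fastforce simp: random_subset_def)

text \<open>Exponential moment method: by independence the moment generating function is a product
  of factors \<open>1 + p * (exp (s * u b) - 1)\<close>, each at most
  \<open>exp (p * (s * u b + s^2))\<close>. The parameter \<open>s\<close> stays free so that each
  tail can choose its own.\<close>

lemma random_subset_chernoff:
  fixes u :: "nat \<Rightarrow> real"
  assumes p: "0 \<le> p" "p \<le> 1" and u: "\<And>b. b < M \<Longrightarrow> \<bar>u b\<bar> \<le> 1" and s: "0 \<le> s" "s \<le> 1"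
  shows "measure_pmf.prob (random_subset M p) {B. t \<le> (\<Sum>b\<in>B. u b)}
           \<le> exp (p * (s * (\<Sum>b<M. u b) + s\<^sup>2 * real M) - s * t)"
proof -
  let ?P = "Pi_pmf {..<M} False (\<lambda>_. bernoulli_pmf p)"
  let ?f = "\<lambda>h. \<Prod>b<M. exp (s * of_bool (h b) * u b)"
  let ?S = "{h. t \<le> (\<Sum>b | h b. u b)}"
  have fin: "finite (set_pmf ?P)"
    by (simp add: set_Pi_pmf finite_PiE_dflt)
  have factor: "p * exp (s * u b) + (1 - p) \<le> exp (p * (s * u b + s\<^sup>2))" if "b < M" for b
  proof -
    have su: "\<bar>s * u b\<bar> \<le> 1"
      using mult_mono[of s 1 "\<bar>u b\<bar>" 1] s u[OF that] by (simp add: abs_mult)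
    have "(s * u b)\<^sup>2 \<le> s\<^sup>2"
      using u[OF that] by (simp add: power_mult_distrib mult_left_le abs_square_le_1)
    then have "exp (s * u b) - 1 \<le> s * u b + s\<^sup>2"
      using exp_le_quadratic[OF su] by simp
    then have "1 + p * (exp (s * u b) - 1) \<le> 1 + p * (s * u b + s\<^sup>2)"
      using p by (simp add: mult_left_mono)
    also have "\<dots> \<le> exp (p * (s * u b + s\<^sup>2))"
      by (rule exp_ge_add_one_self)
    finally show ?thesis by (simp add: algebra_simps)
  qed
  have "measure_pmf.prob (random_subset M p) {B. t \<le> (\<Sum>b\<in>B. u b)}
        = measure_pmf.expectation ?P (indicator ?S)"
    by (simp add: random_subset_def vimage_def)
  \<comment> \<open>Markov's inequality in pointwise form: the indicator of the event is at most
    \<open>exp (s * (sum - t))\<close>.\<close>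
  also have "\<dots> \<le> measure_pmf.expectation ?P (\<lambda>h. ?f h * exp (- s * t))"
  proof (intro integral_mono_AE AE_pmfI)
    fix h assume h: "h \<in> set_pmf ?P"
    have sub: "{b. h b} \<subseteq> {..<M}"
      using h set_Pi_pmf_subset[of "{..<M}" False "\<lambda>_. bernoulli_pmf p"] by fastforce
    have "(\<Sum>b | h b. u b) = (\<Sum>b<M. of_bool (h b) * u b)"
      using sub by (intro sum.mono_neutral_cong_left) auto
    then have "(\<Sum>b<M. s * of_bool (h b) * u b) = s * (\<Sum>b | h b. u b)"
      by (simp only: sum_distrib_left mult.assoc)
    then have "?f h * exp (- s * t) = exp (s * ((\<Sum>b | h b. u b) - t))"
      by (simp only: exp_sum[symmetric] exp_add[symmetric] finite_lessThan right_diff_distrib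
          mult_minus_left add_uminus_conv_diff)
    then show "indicator ?S h \<le> ?f h * exp (- s * t)"
      using s by (auto simp: indicator_def)
  qed (use fin in \<open>auto intro: integrable_measure_pmf_finite\<close>)
  also have "\<dots> = (\<Prod>b<M. p * exp (s * u b) + (1 - p)) * exp (- s * t)"
  proof -
    have "measure_pmf.expectation ?P ?f
          = (\<Prod>b<M. measure_pmf.expectation (bernoulli_pmf p) (\<lambda>v. exp (s * of_bool v * u b)))"
      by (intro expectation_prod_Pi_pmf) (auto intro: integrable_measure_pmf_finite)
    also have "\<dots> = (\<Prod>b<M. p * exp (s * u b) + (1 - p))"
      using p by (simp add: mult.commute)
    finally show ?thesis by simp
  qed
  also have "\<dots> \<le> (\<Prod>b<M. exp (p * (s * u b + s\<^sup>2))) * exp (- s * t)"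
    using factor p by (intro mult_right_mono prod_mono) auto
  also have "\<dots> = exp (p * (s * (\<Sum>b<M. u b) + s\<^sup>2 * real M) - s * t)"
    by (simp add: exp_sum[symmetric] exp_add[symmetric] sum_distrib_left[symmetric] sum.distrib
        mult.commute)
  finally show ?thesis .
qed

subsection \<open>Characters of the cyclic group\<close>

text \<open>The integer argument lets conjugates and differences of residues be formed without
  truncated subtraction.\<close>

definition unity :: "nat \<Rightarrow> int \<Rightarrow> complex" where
  "unity M k = cis (2 * pi * real_of_int k / real M)"

lemma norm_unity [simp]: "cmod (unity M k) = 1"
  by (simp add: unity_def)

lemma unity_0 [simp]: "unity M 0 = 1"
  by (simp add: unity_def)

lemma unity_add: "unity M (k + l) = unity M k * unity M l"
  by (simp add: unity_def cis_mult add_divide_distrib distrib_left)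

lemma cnj_unity: "cnj (unity M k) = unity M (- k)"
  by (simp add: unity_def cis_cnj)

lemma unity_power: "unity M k ^ n = unity M (int n * k)"
  by (simp add: unity_def Complex.DeMoivre mult_ac)

lemma unity_eq_1_iff:
  assumes "M > 0"
  shows "unity M k = 1 \<longleftrightarrow> int M dvd k"
proof -
  have "unity M k = 1 \<longleftrightarrow> (\<exists>n::int. 2 * pi * real_of_int k / real M = 2 * pi * real_of_int n)"
    by (simp add: unity_def cis_conv_exp exp_eq_1 mult_ac)
  also have "\<dots> \<longleftrightarrow> (\<exists>n::int. real_of_int k = real_of_int (int M * n))"
    using assms by (simp add: field_simps)
  also have "\<dots> \<longleftrightarrow> int M dvd k"
    by (simp only: of_int_eq_iff dvd_def)
  finally show ?thesis .
qed

lemma unity_cong: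
  assumes "M > 0" "k mod int M = l mod int M"
  shows "unity M k = unity M l"
proof -
  have "unity M (k - l) = 1"
    using assms by (simp add: unity_eq_1_iff mod_eq_dvd_iff)
  then show ?thesis
    using unity_add[of M "k - l" l] by simp
qed

text \<open>Orthogonality of characters: a geometric sum whose ratio is an \<open>M\<close>-th root
  of unity.\<close>

lemma sum_unity:
  assumes "M > 0"
  shows "(\<Sum>j<M. unity M (int j * k)) = (if int M dvd k then of_nat M else 0)"
proof -
  have "unity M k ^ M = 1"
    using assms by (simp add: unity_power unity_eq_1_iff)
  then show ?thesis
    using sum_gp_strict[of "unity M k" M] assms by (simp add: unity_power unity_eq_1_iff)
qed

text \<open>An unnormalized Fourier coefficient of the indicator of \<open>S\<close>, or
  equivalently an eigenvalue of the directed Cayley graph generated by \<open>S\<close>.\<close>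

definition char_sum :: "nat \<Rightarrow> nat set \<Rightarrow> nat \<Rightarrow> complex" where
  "char_sum M S j = (\<Sum>s\<in>S. unity M (int j * int s))"

lemma char_sum_0 [simp]: "char_sum M S 0 = of_nat (card S)"
  by (simp add: char_sum_def)

lemma dvd_diff_residues_iff:
  assumes "x < M" "y < M"
  shows "int M dvd int x - int y \<longleftrightarrow> x = y"
  using assms by (metis mod_eq_dvd_iff mod_less of_nat_eq_iff of_nat_mod)

text \<open>Once the squared modulus is expanded and the sum over \<open>j\<close> is taken first,
  orthogonality leaves only the diagonal pairs.\<close>

lemma parseval:
  assumes "M > 0" "X \<subseteq> {..<M}"
  shows "(\<Sum>j<M. (cmod (char_sum M X j))\<^sup>2) = real M * real (card X)"
proof -
  have fin: "finite X" using assms(2) finite_subset by blast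
  have "complex_of_real (\<Sum>j<M. (cmod (char_sum M X j))\<^sup>2)
        = (\<Sum>j<M. \<Sum>x\<in>X. \<Sum>y\<in>X. unity M (int j * (int x - int y)))"
    by (simp add: complex_norm_square char_sum_def sum_product cnj_unity unity_add[symmetric]
        right_diff_distrib del: of_real_power)
  also have "\<dots> = (\<Sum>x\<in>X. \<Sum>y\<in>X. \<Sum>j<M. unity M (int j * (int x - int y)))"
    by (subst sum.swap, intro sum.cong[OF refl], rule sum.swap)
  also have "\<dots> = (\<Sum>x\<in>X. \<Sum>y\<in>X. if x = y then of_nat M else 0)"
    using assms dvd_diff_residues_iff[of _ M] by (intro sum.cong) (auto simp: sum_unity)
  also have "\<dots> = complex_of_real (real M * real (card X))"
    using fin by simp
  finally show ?thesis
    by (simp only: of_real_eq_iff)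
qed

text \<open>Summed over all \<open>j\<close>, the products of the coefficients of \<open>A\<close>,
  \<open>X\<close> and (conjugated) \<open>Y\<close> give \<open>M\<close> times the number of
  edges, here 0. The nontrivial characters must therefore cancel the term at \<open>j = 0\<close>,
  and Cauchy-Schwarz with Parseval limits their size.\<close>

lemma mixing_no_edges:
  assumes M: "M > 0" and X: "X \<subseteq> {..<M}" and Y: "Y \<subseteq> {..<M}"
    and bound: "\<And>j. 0 < j \<Longrightarrow> j < M \<Longrightarrow> cmod (char_sum M A j) \<le> l" and l: "0 \<le> l"
    and no_edge: "\<And>a x y. a \<in> A \<Longrightarrow> x \<in> X \<Longrightarrow> y \<in> Y \<Longrightarrow> (x + a) mod M \<noteq> y"
  shows "real (card A) * (real (card X) * real (card Y))
           \<le> l * (real M * sqrt (real (card X) * real (card Y)))"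
proof -
  let ?X = "char_sum M X" and ?Y = "char_sum M Y"
  have expand: "char_sum M A j * (?X j * cnj (?Y j))
        = (\<Sum>a\<in>A. \<Sum>x\<in>X. \<Sum>y\<in>Y. unity M (int j * (int a + int x - int y)))" for j
  proof -
    have "(\<Sum>a\<in>A. \<Sum>x\<in>X. \<Sum>y\<in>Y. unity M (int j * (int a + int x - int y)))
        = (\<Sum>a\<in>A. \<Sum>x\<in>X. \<Sum>y\<in>Y.
            unity M (int j * int a) * (unity M (int j * int x) * cnj (unity M (int j * int y))))"
      by (intro sum.cong refl) (simp add: cnj_unity unity_add[symmetric] algebra_simps)
    then show ?thesis
      by (simp only: sum_distrib_left[symmetric] sum_distrib_right[symmetric] char_sum_def cnj_sum)
  qed
  have "(\<Sum>j<M. char_sum M A j * (?X j * cnj (?Y j)))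
        = (\<Sum>j<M. \<Sum>a\<in>A. \<Sum>x\<in>X. \<Sum>y\<in>Y. unity M (int j * (int a + int x - int y)))"
    by (simp only: expand)
  also have "\<dots> = (\<Sum>a\<in>A. \<Sum>x\<in>X. \<Sum>y\<in>Y. \<Sum>j<M. unity M (int j * (int a + int x - int y)))"
    by (subst sum.swap, intro sum.cong[OF refl], subst sum.swap, intro sum.cong[OF refl],
        rule sum.swap)
  also have "\<dots> = 0"
  proof -
    have "(\<Sum>j<M. unity M (int j * (int a + int x - int y))) = 0"
      if axy: "a \<in> A" "x \<in> X" "y \<in> Y" for a x y
    proof -
      have "\<not> int M dvd int (x + a) - int y"
      proof
        assume "int M dvd int (x + a) - int y"
        then have "(x + a) mod M = y mod M"
          by (metis mod_eq_dvd_iff of_nat_eq_iff of_nat_mod)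
        then show False using no_edge[OF axy] Y axy(3) by auto
      qed
      then show ?thesis
        using M by (simp add: sum_unity add.commute)
    qed
    then show ?thesis
      by (simp only: sum.neutral_const cong: sum.cong)
  qed
  finally have zero: "(\<Sum>j<M. char_sum M A j * (?X j * cnj (?Y j))) = 0" .
  have split: "{..<M} = insert 0 {0<..<M}" using M by auto
  have "of_nat (card A) * (of_nat (card X) * of_nat (card Y))
        = - (\<Sum>j\<in>{0<..<M}. char_sum M A j * (?X j * cnj (?Y j)))"
    using zero unfolding split by (simp add: eq_neg_iff_add_eq_0)
  then have "cmod (of_nat (card A) * (of_nat (card X) * of_nat (card Y)))
        = cmod (\<Sum>j\<in>{0<..<M}. char_sum M A j * (?X j * cnj (?Y j)))"
    by simp
  then have "real (card A) * (real (card X) * real (card Y))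
        = cmod (\<Sum>j\<in>{0<..<M}. char_sum M A j * (?X j * cnj (?Y j)))"
    by (simp only: norm_mult norm_of_nat)
  also have "\<dots> \<le> (\<Sum>j\<in>{0<..<M}. l * (cmod (?X j) * cmod (?Y j)))"
    using bound by (intro sum_norm_le) (auto simp: norm_mult intro!: mult_right_mono)
  also have "\<dots> \<le> (\<Sum>j<M. l * (cmod (?X j) * cmod (?Y j)))"
    using l by (intro sum_mono2) auto
  also have "\<dots> = l * (\<Sum>j<M. cmod (?X j) * cmod (?Y j))"
    by (simp add: sum_distrib_left)
  also have "(\<Sum>j<M. cmod (?X j) * cmod (?Y j)) \<le> real M * sqrt (real (card X) * real (card Y))"
  proof -
    have "(\<Sum>j<M. cmod (?X j) * cmod (?Y j))\<^sup>2 \<le> (real M * real (card X)) * (real M * real (card Y))"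
      using Cauchy_Schwarz_ineq_sum[of "\<lambda>j. cmod (?X j)" "\<lambda>j. cmod (?Y j)" "{..<M}"]
      by (simp add: parseval M X Y)
    then have "(\<Sum>j<M. cmod (?X j) * cmod (?Y j)) \<le> sqrt ((real M * real (card X)) * (real M * real (card Y)))"
      by (rule real_le_rsqrt)
    also have "\<dots> = real M * sqrt (real (card X) * real (card Y))"
      by (simp add: real_sqrt_mult)
    finally show ?thesis .
  qed
  finally show ?thesis
    using l by (simp add: mult_left_mono)
qed

subsection \<open>From expansion to injectivity\<close>

text \<open>Squaring and cancelling equal moduli leaves the real part of \<open>p * cnj q\<close>
  times a cube root of unity.\<close>

lemma polarization:
  assumes "cmod p = cmod p'" "cmod q = cmod q'"
    and "\<And>r::nat. r \<in> {0, 1, 2} \<Longrightarrow>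
      cmod (p + cnj (cis (2 * pi / 3) ^ r) * q) = cmod (p' + cnj (cis (2 * pi / 3) ^ r) * q')"
  shows "p * cnj q = p' * cnj q'"
proof -
  have expand: "(cmod (z + cnj w * z'))\<^sup>2
      = (cmod z)\<^sup>2 + (cmod w)\<^sup>2 * (cmod z')\<^sup>2 + 2 * Re (z * cnj z' * w)" for z z' w
    unfolding cmod_power2 by (simp add: power2_eq_square algebra_simps)
  have re: "Re (p * cnj q * cis (2 * pi / 3) ^ r) = Re (p' * cnj q' * cis (2 * pi / 3) ^ r)"
    if "r \<in> {0, 1, 2}" for r
    using expand[of p "cis (2 * pi / 3) ^ r" q] expand[of p' "cis (2 * pi / 3) ^ r" q']
      assms(1,2) assms(3)[OF that] by simp
  have im: "Im (cis (2 * pi / 3)) \<noteq> 0"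
    using sin_gt_zero[of "2 * pi / 3"] pi_gt_zero by simp
  \<comment> \<open>The real parts of a number and of its product with a fixed nonreal number
    determine it.\<close>
  from re[of 0] re[of 1] im show ?thesis
    by (simp add: complex_eq_iff del: cis.sel)
qed

text \<open>The entries of \<open>x\<close> are the coefficients of a polynomial of degree below
  \<open>M\<close>; if nonzero, it has fewer than \<open>M\<close> roots.\<close>

lemma vec_eq_0_if_poly_roots:
  fixes x :: "complex Matrix.vec"
  assumes x: "x \<in> carrier_vec M" and Z: "finite Z" "M \<le> card Z"
    and roots: "\<And>z. z \<in> Z \<Longrightarrow> (\<Sum>i<M. x $ i * z ^ i) = 0"
  shows "x = 0\<^sub>v M"
proof -
  define p where "p = (\<Sum>i<M. Polynomial.monom (x $ i) i)"
  have coeff_p: "poly.coeff p i = x $ i" if "i < M" for i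
    using that by (simp add: p_def coeff_sum)
  have p: "p = 0"
  proof (rule ccontr)
    assume "p \<noteq> 0"
    then have "M > 0" by (cases M) (auto simp: p_def)
    have "Z \<subseteq> {z. poly p z = 0}"
      using roots by (auto simp: p_def poly_sum poly_monom)
    then have "card Z \<le> card {z. poly p z = 0}"
      by (intro card_mono poly_roots_finite \<open>p \<noteq> 0\<close>)
    also have "\<dots> \<le> Polynomial.degree p"
      by (rule card_poly_roots_bound[OF \<open>p \<noteq> 0\<close>])
    also have "\<dots> < M"
      unfolding p_def using \<open>M > 0\<close>
      by (intro degree_sum_less) (auto intro: le_less_trans[OF degree_monom_le])
    finally show False using Z by simp
  qed
  show ?thesis
    using x coeff_p p by (intro eq_vecI) auto
qed

text \<open>The conjugate and the minus sign arise because \<open>\<bullet>c\<close> conjugates its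
  second argument, the masked sinusoid.\<close>

definition node :: "nat \<Rightarrow> complex \<Rightarrow> nat \<Rightarrow> complex" where
  "node M z m = cnj z * unity M (- int m)"

definition sample :: "nat \<Rightarrow> complex Matrix.vec \<Rightarrow> complex \<Rightarrow> nat \<Rightarrow> complex" where
  "sample M x z m = (\<Sum>i<M. x $ i * node M z m ^ i) / of_nat M"

text \<open>Taking \<open>M\<close>-th powers erases the root of unity, so equal nodes would make a
  quotient of two numbers \<open>\<alpha> k\<close> an \<open>M\<close>-th root of unity unless the
  indices agree; for one index the nodes differ by distinct roots of unity.\<close>

lemma node_inj_on:
  assumes M: "M > 0" and nz: "\<And>k. k < K \<Longrightarrow> \<alpha> k \<noteq> 0"
    and not_root: "\<And>k k'. k < K \<Longrightarrow> k' < K \<Longrightarrow> k \<noteq> k' \<Longrightarrow> (\<alpha> k * inverse (\<alpha> k')) ^ M \<noteq> 1"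
  shows "inj_on (\<lambda>(k, m). node M (\<alpha> k) m) ({..<K} \<times> {..<M})"
proof (rule inj_onI, clarify)
  fix k m k' m'
  assume km: "k < K" "m < M" "k' < K" "m' < M" and eq: "node M (\<alpha> k) m = node M (\<alpha> k') m'"
  have power: "unity M (- int m) ^ M = 1" for m
    using M by (simp add: unity_power unity_eq_1_iff)
  have "cnj (\<alpha> k) ^ M = cnj (\<alpha> k') ^ M"
    using arg_cong[OF eq, of "\<lambda>z. z ^ M"] by (simp add: node_def power_mult_distrib power)
  then have "\<alpha> k ^ M = \<alpha> k' ^ M"
    by (simp flip: complex_cnj_power)
  then have "(\<alpha> k * inverse (\<alpha> k')) ^ M = 1"
    using nz[OF km(3)] by (simp add: power_mult_distrib power_inverse)
  then have k: "k = k'"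
    using not_root[OF km(1,3)] by auto
  then have "unity M (- int m) = unity M (- int m')"
    using eq nz[OF km(3)] by (simp add: node_def)
  then have "unity M (int m' - int m) = 1"
    using unity_add[of M "int m'" "- int m"] unity_add[of M "int m'" "- int m'"] by simp
  then show "k = k' \<and> m = m'"
    using k M km dvd_diff_residues_iff[of m' M m] by (simp add: unity_eq_1_iff)
qed

lemma cscalar_prod_diag_sinusoid:
  assumes "x \<in> carrier_vec M"
  shows "x \<bullet>c (mat_diag M d *\<^sub>v sinusoid M m)
           = (\<Sum>i<M. x $ i * (cnj (d i) * unity M (- (int m * int i)))) / of_nat M"
proof -
  have entry: "(mat_diag M d *\<^sub>v sinusoid M m) $ i = d i * unity M (int m * int i) / of_nat M"
    if "i < M" for i
    using that
    by (simp add: mat_diag_def sinusoid_def unity_def scalar_prod_def if_distrib[of "\<lambda>z. z * _"]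
        if_distrib[of "\<lambda>z. z / _"]
        mult.assoc cong: if_cong)
  have dim: "dim_row (mat_diag M d) = M"
    by (simp add: mat_diag_def)
  have "x \<bullet>c (mat_diag M d *\<^sub>v sinusoid M m)
      = (\<Sum>i<M. x $ i * cnj (d i * unity M (int m * int i) / of_nat M))"
    unfolding scalar_prod_def by (simp add: dim entry atLeast0LessThan del: index_mult_mat_vec)
  then show ?thesis
    by (simp add: cnj_unity sum_divide_distrib)
qed

lemma cscalar_prod_power_mask:
  assumes "x \<in> carrier_vec M"
  shows "x \<bullet>c (power_mask M z *\<^sub>v sinusoid M m) = sample M x z m"
  by (simp add: power_mask_def cscalar_prod_diag_sinusoid[OF assms] sample_def node_def
      power_mult_distrib unity_power mult.commute)

lemma modulation_power: "modulation M ^\<^sub>m a = mat_diag M (\<lambda>i. unity M (int a * int i))"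
proof (induction a)
  case 0
  then show ?case by (simp add: modulation_def mat_diag_def)
next
  case (Suc a)
  have "modulation M = mat_diag M (\<lambda>i. unity M (int i))"
    by (simp add: modulation_def unity_def)
  with Suc show ?case
    by (simp add: unity_add[symmetric] algebra_simps)
qed

text \<open>Modulation to the power \<open>a\<close> shifts the frequency \<open>m\<close> to
  \<open>m + a\<close>, so a sum mask couples the samples at two vertices.\<close>

lemma cscalar_prod_sum_mask:
  assumes M: "M > 0" and x: "x \<in> carrier_vec M"
  shows "x \<bullet>c ((power_mask M z + w \<cdot>\<^sub>m (modulation M ^\<^sub>m a * power_mask M z')) *\<^sub>v sinusoid M m)
           = sample M x z m + cnj w * sample M x z' ((m + a) mod M)"
proof -
  have mask: "power_mask M z + w \<cdot>\<^sub>m (modulation M ^\<^sub>m a * power_mask M z')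
      = mat_diag M (\<lambda>i. z ^ i + w * (unity M (int a * int i) * z' ^ i))"
    by (simp add: power_mask_def modulation_power) (auto simp: mat_diag_def)
  have shift: "unity M (- int ((m + a) mod M)) = unity M (- int m) * unity M (- int a)"
    unfolding unity_add[symmetric] using M
    by (intro unity_cong) (simp_all add: zmod_int mod_minus_eq)
  have summand: "cnj (z ^ i + w * (unity M (int a * int i) * z' ^ i)) * unity M (- (int m * int i))
      = node M z m ^ i + cnj w * node M z' ((m + a) mod M) ^ i" for i
    unfolding node_def shift
    by (simp add: power_mult_distrib unity_power cnj_unity algebra_simps)
  show ?thesis
    unfolding mask cscalar_prod_diag_sinusoid[OF x] summand
    by (simp add: sample_def distrib_left sum.distrib add_divide_distrib sum_distrib_left mult_ac)
qed

text \<open>Greedy choice: when adding one element first brings the total to \<open>t\<close>, the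
  overshoot is below \<open>n\<close>.\<close>

lemma subset_weight_between:
  fixes w :: "'a \<Rightarrow> nat"
  assumes "finite I" "\<And>i. i \<in> I \<Longrightarrow> w i < n" "t \<le> sum w I" "n > 0"
  shows "\<exists>J\<subseteq>I. t \<le> sum w J \<and> sum w J < t + n"
  using assms
proof (induction I rule: finite_induct)
  case empty
  then show ?case by auto
next
  case (insert i I)
  show ?case
  proof (cases "t \<le> sum w I")
    case True
    with insert obtain J where "J \<subseteq> I" "t \<le> sum w J \<and> sum w J < t + n"
      by auto
    then show ?thesis by blast
  next
    case False
    have "w i < n" using insert.prems by simp
    then show ?thesis
      using False insert.hyps insert.prems(2) by (intro exI[of _ "insert i I"]) auto
  qed
qed

text \<open>The density 5/12 is what remains when a set of at least \<open>5 * M\<close> among the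
  \<open>12 * M\<close> vertices is projected to residues.\<close>

definition expanding :: "nat \<Rightarrow> nat set \<Rightarrow> bool" where
  "expanding M A \<longleftrightarrow> (\<forall>X Y. X \<subseteq> {..<M} \<longrightarrow> Y \<subseteq> {..<M} \<longrightarrow> 5 * M \<le> 12 * card X \<longrightarrow> 5 * M \<le> 12 * card Y \<longrightarrow>
     (\<exists>a\<in>A. \<exists>x\<in>X. \<exists>y\<in>Y. (x + a) mod M = y))"

text \<open>If every phase class had fewer than \<open>M\<close> vertices, a union of classes and its complement
  would both be large, so expansion would produce an edge between different classes.\<close>

lemma large_phase_class:
  fixes \<rho> :: "nat \<times> nat \<Rightarrow> 'a"
  assumes M: "M > 0" and S: "S \<subseteq> {..<12} \<times> {..<M}" "11 * M < card S"
    and exp: "expanding M A"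
    and edge: "\<And>k m k' a. a \<in> A \<Longrightarrow> (k, m) \<in> S \<Longrightarrow> (k', (m + a) mod M) \<in> S \<Longrightarrow>
                 \<rho> (k, m) = \<rho> (k', (m + a) mod M)"
  shows "\<exists>\<theta>. M \<le> card {v \<in> S. \<rho> v = \<theta>}"
proof (rule ccontr)
  assume "\<not> ?thesis"
  then have small: "card {v \<in> S. \<rho> v = \<theta>} < M" for \<theta>
    by (meson not_le)
  have fin: "finite S"
    using S(1) by (rule finite_subset) auto
  have weight: "(\<Sum>\<theta>\<in>J. card {v \<in> S. \<rho> v = \<theta>}) = card {v \<in> S. \<rho> v \<in> J}" if "finite J" for J
  proof -
    have "{v \<in> S. \<rho> v \<in> J} = (\<Union>\<theta>\<in>J. {v \<in> S. \<rho> v = \<theta>})" by auto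
    then show ?thesis
      using that fin by (simp only:) (subst card_UN_disjoint, auto)
  qed
  have "5 * M \<le> (\<Sum>\<theta>\<in>\<rho> ` S. card {v \<in> S. \<rho> v = \<theta>})"
    using S(2) by (subst weight) (auto simp: fin cong: conj_cong)
  then obtain J where J: "J \<subseteq> \<rho> ` S" and
    lower: "5 * M \<le> (\<Sum>\<theta>\<in>J. card {v \<in> S. \<rho> v = \<theta>})" and
    upper: "(\<Sum>\<theta>\<in>J. card {v \<in> S. \<rho> v = \<theta>}) < 5 * M + M"
    using subset_weight_between[of "\<rho> ` S" "\<lambda>\<theta>. card {v \<in> S. \<rho> v = \<theta>}" M "5 * M"] fin small M
    by auto
  have finJ: "finite J" using J fin finite_subset by blast
  define T where "T = {v \<in> S. \<rho> v \<in> J}"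
  have T: "T \<subseteq> S" "5 * M \<le> card T" "card T < 6 * M"
    using lower upper weight[OF finJ] by (auto simp: T_def)
  \<comment> \<open>More than \<open>11 * M\<close> vertices, less fewer than
    \<open>6 * M\<close>.\<close>
  have rest: "5 * M \<le> card (S - T)"
    using card_Diff_subset[of T S] T S(2) fin finite_subset[OF T(1) fin] by simp
  \<comment> \<open>Each residue lies below at most 12 vertices.\<close>
  have proj: "card U \<le> 12 * card (snd ` U)" if "U \<subseteq> S" for U
  proof -
    have "U \<subseteq> {..<12} \<times> snd ` U"
      using that S(1) by force
    then have "card U \<le> card ({..<12::nat} \<times> snd ` U)"
      using finite_subset[OF that fin] by (intro card_mono) auto
    then show ?thesis by (simp add: card_cartesian_product)
  qed
  have "snd ` T \<subseteq> {..<M}" "snd ` (S - T) \<subseteq> {..<M}"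
    using S(1) T(1) by auto
  moreover have "5 * M \<le> 12 * card (snd ` T)" "5 * M \<le> 12 * card (snd ` (S - T))"
    using proj[OF T(1)] proj[of "S - T"] T(2) rest by auto
  ultimately obtain a x y where a: "a \<in> A" and x: "x \<in> snd ` T" and y: "y \<in> snd ` (S - T)"
    and xy: "(x + a) mod M = y"
    using exp[unfolded expanding_def, rule_format, of "snd ` T" "snd ` (S - T)"] by blast
  obtain k where k: "(k, x) \<in> T" using x by auto
  obtain k' where k': "(k', y) \<in> S - T" using y by auto
  have "\<rho> (k, x) = \<rho> (k', y)"
    using edge[OF a, of k x k'] k k' T(1) xy by auto
  then show False using k k' by (auto simp: T_def)
qed

text \<open>Expansion is asked of \<open>B - {0}\<close> only. The negatives in
  \<open>connection_set\<close> serve to reverse edges, since the masks cover only index pairs with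
  \<open>k' \<le> k\<close>.\<close>

lemma injective_if_expanding:
  assumes M: "M > 0" and nz: "\<And>k. k < 12 \<Longrightarrow> \<alpha> k \<noteq> 0"
    and not_root: "\<And>k k'. k < 12 \<Longrightarrow> k' < 12 \<Longrightarrow> k \<noteq> k' \<Longrightarrow> (\<alpha> k * inverse (\<alpha> k')) ^ M \<noteq> 1"
    and B: "B \<subseteq> {..<M}" and exp: "expanding M (B - {0})"
  shows "injective_intensities M (masks M 12 \<alpha> (connection_set M B))"
  unfolding injective_intensities_def
proof (intro ballI impI)
  fix x y :: "complex Matrix.vec"
  assume x: "x \<in> carrier_vec M" and y: "y \<in> carrier_vec M"
    and same: "\<forall>D\<in>masks M 12 \<alpha> (connection_set M B). \<forall>m<M.
      intensity x (D *\<^sub>v sinusoid M m) = intensity y (D *\<^sub>v sinusoid M m)"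
  let ?V = "{..<12::nat} \<times> {..<M}"
  define X where "X = (\<lambda>(k, m). sample M x (\<alpha> k) m)"
  define Y where "Y = (\<lambda>(k, m). sample M y (\<alpha> k) m)"
  note inj = node_inj_on[of M 12 \<alpha>, OF M nz not_root, simplified]
  \<comment> \<open>Applied below to \<open>y\<close>, to \<open>x\<close> and to
    \<open>y - \<theta> x\<close>.\<close>
  have zero: "v = 0\<^sub>v M"
    if v: "v \<in> carrier_vec M" and W: "W \<subseteq> ?V" "M \<le> card W"
      and "\<And>k m. (k, m) \<in> W \<Longrightarrow> sample M v (\<alpha> k) m = 0" for v W
  proof (rule vec_eq_0_if_poly_roots[OF v])
    let ?Z = "(\<lambda>(k, m). node M (\<alpha> k) m) ` W"
    show "finite ?Z" using finite_subset[OF W(1)] by simp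
    show "M \<le> card ?Z"
      using W(2) card_image[OF inj_on_subset[OF inj W(1)]] by simp
    show "(\<Sum>i<M. v $ i * z ^ i) = 0" if "z \<in> ?Z" for z
      using that \<open>\<And>k m. (k, m) \<in> W \<Longrightarrow> sample M v (\<alpha> k) m = 0\<close> M
      by (auto simp: sample_def)
  qed
  have vertex: "cmod (X (k, m)) = cmod (Y (k, m))" if "k < 12" "m < M" for k m
  proof -
    have "power_mask M (\<alpha> k) \<in> masks M 12 \<alpha> (connection_set M B)"
      using that by (auto simp: masks_def)
    with same that x y show ?thesis
      by (force simp: intensity_def cscalar_prod_power_mask X_def Y_def)
  qed
  have directed: "X (k, m) * cnj (X (k', (m + a) mod M)) = Y (k, m) * cnj (Y (k', (m + a) mod M))"
    if "k < 12" "k' \<le> k" "m < M" "a \<in> connection_set M B" for k m k' a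
  proof (rule polarization)
    show "cmod (X (k, m)) = cmod (Y (k, m))" using vertex that by simp
    show "cmod (X (k', (m + a) mod M)) = cmod (Y (k', (m + a) mod M))"
      using vertex that by simp
    fix r :: nat assume r: "r \<in> {0, 1, 2}"
    let ?D = "power_mask M (\<alpha> k)
        + cis (2 * pi / 3) ^ r \<cdot>\<^sub>m (modulation M ^\<^sub>m a * power_mask M (\<alpha> k'))"
    have "?D \<in> masks M 12 \<alpha> (connection_set M B)"
      unfolding masks_def using that r by blast
    then have "intensity x (?D *\<^sub>v sinusoid M m) = intensity y (?D *\<^sub>v sinusoid M m)"
      using same that by blast
    then show "cmod (X (k, m) + cnj (cis (2 * pi / 3) ^ r) * X (k', (m + a) mod M))
        = cmod (Y (k, m) + cnj (cis (2 * pi / 3) ^ r) * Y (k', (m + a) mod M))"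
      by (simp add: intensity_def cscalar_prod_sum_mask M x y X_def Y_def del: complex_cnj_power)
  qed
  have edge: "X (k, m) * cnj (X (k', (m + b) mod M)) = Y (k, m) * cnj (Y (k', (m + b) mod M))"
    if "k < 12" "k' < 12" "m < M" "b \<in> B - {0}" for k m k' b
  proof (cases "k' \<le> k")
    case True
    then show ?thesis
      using that by (intro directed) (auto simp: connection_set_def)
  next
    \<comment> \<open>Here the edge is read backwards: the step \<open>M - b\<close> leads from
      \<open>(m + b) mod M\<close> to \<open>m\<close>, and conjugation restores the order of the
      factors.\<close>
    case False
    have b: "b < M" "b \<noteq> 0" using that B by auto
    have "nat ((- int b) mod int M) = M - b"
      using b by (simp add: zmod_zminus1_eq_if nat_diff_distrib')
    then have "M - b \<in> neg_residues M B"
      unfolding neg_residues_def using that by (intro image_eqI[of _ _ b]) simp_all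
    then have "M - b \<in> connection_set M B"
      using b by (simp add: connection_set_def)
    moreover have "((m + b) mod M + (M - b)) mod M = m"
      using b that by (simp only: mod_add_left_eq) simp
    ultimately have "X (k', (m + b) mod M) * cnj (X (k, m)) = Y (k', (m + b) mod M) * cnj (Y (k, m))"
      using directed[of k' k "(m + b) mod M" "M - b"] False that M by simp
    from arg_cong[OF this, of cnj] show ?thesis
      by (simp add: mult.commute)
  qed
  show "\<exists>\<theta>. cmod \<theta> = 1 \<and> y = \<theta> \<cdot>\<^sub>v x"
  proof (cases "x = 0\<^sub>v M")
    case True
    have "sample M y (\<alpha> k) m = 0" if "(k, m) \<in> ?V" for k m
      using vertex[of k m] that True by (simp add: X_def Y_def sample_def)
    then have "y = 0\<^sub>v M"
      by (intro zero[OF y order_refl]) auto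
    with True show ?thesis by (intro exI[of _ 1]) auto
  next
    case False
    define S where "S = {v \<in> ?V. X v \<noteq> 0}"
    define \<rho> where "\<rho> v = Y v / X v" for v
    \<comment> \<open>Otherwise \<open>x\<close> would vanish at \<open>M\<close> nodes and hence be
      zero.\<close>
    have "card (?V - S) < M"
    proof (rule ccontr)
      assume "\<not> card (?V - S) < M"
      then have "x = 0\<^sub>v M"
        by (intro zero[OF x, of "?V - S"]) (auto simp: S_def X_def)
      with False show False by simp
    qed
    moreover have "card S + card (?V - S) = 12 * M"
    proof -
      have S: "S \<subseteq> ?V" "finite S" by (auto simp: S_def)
      have "card S \<le> card ?V" by (intro card_mono S) simp
      with card_Diff_subset[OF S(2,1)] show ?thesis
        by (simp add: card_cartesian_product)
    qed
    ultimately have card_S: "11 * M < card S" by simp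
    have norm_\<rho>: "cmod (\<rho> v) = 1" if "v \<in> S" for v
      using that vertex by (auto simp: S_def \<rho>_def norm_divide)
    have "\<exists>\<theta>. M \<le> card {v \<in> S. \<rho> v = \<theta>}"
    proof (rule large_phase_class[OF M _ card_S exp])
      show "S \<subseteq> ?V" by (auto simp: S_def)
      fix k m k' a
      assume a: "a \<in> B - {0}" and v: "(k, m) \<in> S" and w: "(k', (m + a) mod M) \<in> S"
      let ?w = "(k', (m + a) mod M)"
      have "X (k, m) * cnj (X ?w) = Y (k, m) * cnj (Y ?w)"
        using v w a by (intro edge) (auto simp: S_def)
      then have "\<rho> (k, m) * cnj (\<rho> ?w) = 1"
        using v w by (auto simp: \<rho>_def S_def field_simps)
      \<comment> \<open>Ratios have modulus 1, so the conjugate of a ratio is its inverse and both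
        ratios agree.\<close>
      moreover have "\<rho> ?w * cnj (\<rho> ?w) = 1"
        using norm_\<rho>[OF w] by (simp flip: complex_norm_square)
      ultimately show "\<rho> (k, m) = \<rho> ?w"
        by (metis mult_cancel_right mult_zero_right zero_neq_one)
    qed
    then obtain \<theta> where \<theta>: "M \<le> card {v \<in> S. \<rho> v = \<theta>}" by blast
    then obtain v where "v \<in> S" "\<rho> v = \<theta>"
      using M by (metis (mono_tags, lifting) Collect_empty_eq card.empty leD)
    then have "cmod \<theta> = 1" using norm_\<rho> by blast
    moreover have "y - \<theta> \<cdot>\<^sub>v x = 0\<^sub>v M"
    proof (rule zero[OF _ _ \<theta>])
      show "y - \<theta> \<cdot>\<^sub>v x \<in> carrier_vec M" using x y by simp
      show "{v \<in> S. \<rho> v = \<theta>} \<subseteq> ?V" by (auto simp: S_def)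
      fix k m assume "(k, m) \<in> {v \<in> S. \<rho> v = \<theta>}"
      then have "Y (k, m) = \<theta> * X (k, m)"
        by (auto simp: S_def \<rho>_def)
      moreover have "sample M (y - \<theta> \<cdot>\<^sub>v x) (\<alpha> k) m = Y (k, m) - \<theta> * X (k, m)"
        using x y by (simp add: sample_def X_def Y_def sum_distrib_left algebra_simps
            flip: diff_divide_distrib sum_subtractf)
      ultimately show "sample M (y - \<theta> \<cdot>\<^sub>v x) (\<alpha> k) m = 0" by simp
    qed
    then have "y = \<theta> \<cdot>\<^sub>v x"
      using x y by (metis carrier_vecD eq_vecI index_minus_vec(1) index_smult_vec(2)
          index_zero_vec(1) right_minus_eq)
    ultimately show ?thesis by blast
  qed
qed

subsection \<open>Random subsets are expanding\<close>

text \<open>Chernoff with \<open>s = 1\<close>. The constant 427 is the largest integer whose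
  product with 468, the number of sum masks allowed per element of \<open>B\<close>, stays below
  \<open>2 * 10 ^ 5\<close>.\<close>

lemma real_card_random_subset_upper:
  assumes p: "0 \<le> p" "p \<le> 1" and mean: "p * real M = 144 * L"
  shows "measure_pmf.prob (random_subset M p) {B. 427 * L \<le> real (card B)} \<le> exp (- 139 * L)"
proof -
  have exponent: "p * (1 * (\<Sum>b<M. 1) + 1\<^sup>2 * real M) - 1 * (427 * L) = - 139 * L"
    using mean by (simp add: distrib_left)
  show ?thesis
    using random_subset_chernoff[OF p, of M "\<lambda>_. 1" 1 "427 * L"] unfolding exponent by simp
qed

text \<open>Chernoff for weights -1; \<open>s = 1 / 16\<close> is close to the minimizer 19/288 of
  \<open>144 * s^2 - 19 * s\<close>.\<close>

lemma real_card_random_subset_lower: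
  assumes p: "0 \<le> p" "p \<le> 1" and mean: "p * real M = 144 * L"
  shows "measure_pmf.prob (random_subset M p) {B. real (card B) \<le> 125 * L} \<le> exp (- 5 / 8 * L)"
proof -
  have "p * ((1 / 16) * - real M + (1 / 16)\<^sup>2 * real M) = - (15 / 256) * (p * real M)"
    by (simp add: power2_eq_square algebra_simps)
  then have "p * ((1 / 16) * - real M + (1 / 16)\<^sup>2 * real M) - (1 / 16) * - (125 * L) = - 5 / 8 * L"
    by (simp only: mean)
  then show ?thesis
    using random_subset_chernoff[OF p, of M "\<lambda>_. - 1" "1 / 16" "- (125 * L)"] by simp
qed

text \<open>Here \<open>s = 1 / 8\<close> minimizes \<open>144 * s^2 - 36 * s\<close>. The resulting
  rate 9/4 exceeds 1, so the bound survives a union over \<open>M\<close> characters.\<close>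

lemma random_subset_balanced:
  assumes p: "0 \<le> p" "p \<le> 1" and mean: "p * real M = 144 * L"
    and u: "\<And>b. b < M \<Longrightarrow> \<bar>u b\<bar> \<le> 1" and balanced: "(\<Sum>b<M. u b) = 0"
  shows "measure_pmf.prob (random_subset M p) {B. 36 * L \<le> (\<Sum>b\<in>B. u b)} \<le> exp (- 9 / 4 * L)"
proof -
  have exponent: "p * ((1 / 8) * (\<Sum>b<M. u b) + (1 / 8)\<^sup>2 * real M) - (1 / 8) * (36 * L) = - 9 / 4 * L"
    using mean balanced by (simp add: power2_eq_square)
  show ?thesis
    using random_subset_chernoff[where u = u and M = M and s = "1 / 8" and t = "36 * L", OF p u]
    unfolding exponent by simp
qed

lemma char_sum_full:
  assumes "0 < j" "j < M"
  shows "char_sum M {..<M} j = 0"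
proof -
  have "\<not> int M dvd int j"
    using assms by (simp add: nat_dvd_not_less)
  then show ?thesis
    using sum_unity[of M "int j"] assms by (simp add: char_sum_def mult.commute)
qed

text \<open>The real and imaginary parts of the character sum are bounded separately, which accounts for
  the four tails and for \<open>51 > 36 \<surd>2\<close>.\<close>

lemma random_subset_char_sum:
  assumes p: "0 \<le> p" "p \<le> 1" and mean: "p * real M = 144 * L" and L: "0 \<le> L"
    and j: "0 < j" "j < M"
  shows "measure_pmf.prob (random_subset M p) {B. 51 * L < cmod (char_sum M B j)} \<le> 4 * exp (- 9 / 4 * L)"
proof -
  let ?R = "random_subset M p" and ?w = "\<lambda>b. unity M (int j * int b)"
  define T where "T u = {B. 36 * L \<le> (\<Sum>b\<in>B. u b)}" for u :: "nat \<Rightarrow> real"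
  have balanced: "(\<Sum>b<M. Re (?w b)) = 0" "(\<Sum>b<M. Im (?w b)) = 0"
    using char_sum_full[OF j] by (simp_all add: char_sum_def complex_eq_iff)
  have tail: "measure_pmf.prob ?R (T u) \<le> exp (- 9 / 4 * L)"
    if "u \<in> {\<lambda>b. Re (?w b), \<lambda>b. - Re (?w b), \<lambda>b. Im (?w b), \<lambda>b. - Im (?w b)}" for u
    unfolding T_def using that balanced abs_Re_le_cmod[of "?w _"] abs_Im_le_cmod[of "?w _"]
    by (intro random_subset_balanced[OF p mean]) (auto simp: sum_negf)
  have "B \<in> T (\<lambda>b. Re (?w b)) \<union> T (\<lambda>b. - Re (?w b)) \<union> (T (\<lambda>b. Im (?w b)) \<union> T (\<lambda>b. - Im (?w b)))"
    if "51 * L < cmod (char_sum M B j)" for B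
  proof (rule ccontr)
    assume "\<not> ?thesis"
    then have re: "\<bar>Re (char_sum M B j)\<bar> \<le> 36 * L" and im: "\<bar>Im (char_sum M B j)\<bar> \<le> 36 * L"
      by (auto simp: T_def char_sum_def sum_negf)
    have "(cmod (char_sum M B j))\<^sup>2 \<le> (36 * L)\<^sup>2 + (36 * L)\<^sup>2"
      unfolding cmod_power2 using power_mono[OF re, of 2] power_mono[OF im, of 2] by simp
    also have "\<dots> \<le> (51 * L)\<^sup>2"
      by (simp add: power_mult_distrib)
    finally have "cmod (char_sum M B j) \<le> 51 * L"
      by (rule power2_le_imp_le) (use L in simp)
    with that show False by simp
  qed
  then have "measure_pmf.prob ?R {B. 51 * L < cmod (char_sum M B j)}
      \<le> measure_pmf.prob ?R (T (\<lambda>b. Re (?w b)) \<union> T (\<lambda>b. - Re (?w b)) \<union>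
          (T (\<lambda>b. Im (?w b)) \<union> T (\<lambda>b. - Im (?w b))))"
    by (intro measure_pmf.finite_measure_mono) auto
  also have "\<dots> \<le> (measure_pmf.prob ?R (T (\<lambda>b. Re (?w b))) + measure_pmf.prob ?R (T (\<lambda>b. - Re (?w b)))) +
      (measure_pmf.prob ?R (T (\<lambda>b. Im (?w b))) + measure_pmf.prob ?R (T (\<lambda>b. - Im (?w b))))"
    by (rule order_trans[OF measure_Un_le add_mono[OF measure_Un_le measure_Un_le]]) simp_all
  also have "\<dots> \<le> 4 * exp (- 9 / 4 * L)"
    using tail[of "\<lambda>b. Re (?w b)"] tail[of "\<lambda>b. - Re (?w b)"]
      tail[of "\<lambda>b. Im (?w b)"] tail[of "\<lambda>b. - Im (?w b)"] by simp
  finally show ?thesis .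
qed

text \<open>Without an edge, mixing would force \<open>(125 * L - 1) * 5 / 12 < 51 * L + 1\<close>,
  that is \<open>L < 17 / 13\<close>. The corrections by 1 account for deleting the residue
  0.\<close>

lemma expanding_if_char_sum:
  assumes M: "M > 0" and B: "finite B" and L: "2 \<le> L" and card: "125 * L < real (card B)"
    and bound: "\<And>j. 0 < j \<Longrightarrow> j < M \<Longrightarrow> cmod (char_sum M B j) \<le> 51 * L"
  shows "expanding M (B - {0})"
  unfolding expanding_def
proof (intro allI impI, rule ccontr)
  fix X Y
  assume X: "X \<subseteq> {..<M}" "5 * M \<le> 12 * card X" and Y: "Y \<subseteq> {..<M}" "5 * M \<le> 12 * card Y"
    and no_edge: "\<not> (\<exists>a\<in>B - {0}. \<exists>x\<in>X. \<exists>y\<in>Y. (x + a) mod M = y)"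
  let ?P = "real (card X) * real (card Y)"
  have bound': "cmod (char_sum M (B - {0}) j) \<le> 51 * L + 1" if "0 < j" "j < M" for j
  proof (cases "0 \<in> B")
    case True
    then have "char_sum M (B - {0}) j = char_sum M B j - 1"
      using B by (simp add: char_sum_def sum_diff1)
    then have "cmod (char_sum M (B - {0}) j) \<le> cmod (char_sum M B j) + 1"
      using norm_triangle_ineq4[of "char_sum M B j" 1] by simp
    with bound[OF that] show ?thesis by simp
  next
    case False
    with bound[OF that] show ?thesis by simp
  qed
  have card': "125 * L - 1 < real (card (B - {0}))"
  proof -
    have "card B \<le> card (B - {0}) + 1"
    proof (cases "0 \<in> B")
      case True
      show ?thesis by (simp only: card.remove[OF B True])
    qed simp
    with card show ?thesis by linarith
  qed
  have "(5 * real M / 12)\<^sup>2 \<le> ?P"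
    unfolding power2_eq_square using X(2) Y(2) by (intro mult_mono) auto
  then have root: "5 * real M / 12 \<le> sqrt ?P"
    by (rule real_le_rsqrt)
  have pos: "0 < sqrt ?P"
    using root M by (intro less_le_trans[OF _ root]) simp
  have "real (card (B - {0})) * (sqrt ?P * sqrt ?P) \<le> (51 * L + 1) * (real M * sqrt ?P)"
    using mixing_no_edges[OF M X(1) Y(1) bound'] no_edge L by auto
  then have "(real (card (B - {0})) * sqrt ?P) * sqrt ?P \<le> ((51 * L + 1) * real M) * sqrt ?P"
    by (simp only: mult.assoc)
  then have "real (card (B - {0})) * sqrt ?P \<le> (51 * L + 1) * real M"
    using pos by (rule mult_right_le_imp_le)
  moreover have "(125 * L - 1) * (5 * real M / 12) < real (card (B - {0})) * sqrt ?P"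
    using card' root L M by (intro mult_less_le_imp_less) auto
  ultimately have "(125 * L - 1) * (5 * real M / 12) < (51 * L + 1) * real M"
    by (rule less_le_trans[rotated])
  then have "((125 * L - 1) * 5 / 12) * real M < (51 * L + 1) * real M"
    by (simp only: times_divide_eq_left times_divide_eq_right mult.assoc)
  then have "(125 * L - 1) * 5 / 12 < 51 * L + 1"
    using M by simp
  then show False using L by simp
qed

text \<open>There are 78 pairs \<open>k' \<le> k\<close> and 3 cube roots of unity, hence at most
  234 masks per element of the connection set, which has at most twice the size of
  \<open>B\<close>.\<close>

lemma masks_card:
  assumes B: "finite B"
  shows "finite (masks M 12 \<alpha> (connection_set M B))"
    and "card (masks M 12 \<alpha> (connection_set M B)) \<le> 12 + 468 * card B"
proof -
  let ?A = "connection_set M B"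
  let ?I = "(SIGMA k:{..<12::nat}. {..k}) \<times> {0, 1, 2::nat} \<times> ?A"
  let ?f = "\<lambda>((k, k'), r, a). power_mask M (\<alpha> k)
      + cis (2 * pi / 3) ^ r \<cdot>\<^sub>m (modulation M ^\<^sub>m a * power_mask M (\<alpha> k'))"
  have A: "finite ?A" "card ?A \<le> 2 * card B"
  proof -
    show "finite ?A"
      using B by (simp add: connection_set_def neg_residues_def)
    have "card ?A \<le> card (B \<union> neg_residues M B)"
      using B by (intro card_mono) (auto simp: connection_set_def neg_residues_def)
    also have "\<dots> \<le> card B + card (neg_residues M B)"
      by (rule card_Un_le)
    also have "\<dots> \<le> 2 * card B"
      using card_image_le[OF B] by (simp add: neg_residues_def)
    finally show "card ?A \<le> 2 * card B" .
  qed
  have eq: "masks M 12 \<alpha> ?A = (\<lambda>k. power_mask M (\<alpha> k)) ` {..<12} \<union> ?f ` ?I"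
    unfolding masks_def by (intro arg_cong2[of _ _ _ _ "(\<union>)"]) (auto simp: image_iff, blast+)
  show "finite (masks M 12 \<alpha> ?A)"
    unfolding eq using A by auto
  have "card ?I = 234 * card ?A"
    by (simp add: card_cartesian_product eval_nat_numeral)
  then have "card (?f ` ?I) \<le> 234 * card ?A"
    using card_image_le[of ?I ?f] A by auto
  moreover have "card ((\<lambda>k. power_mask M (\<alpha> k)) ` {..<12}) \<le> 12"
    using card_image_le[of "{..<12::nat}"] by force
  ultimately show "card (masks M 12 \<alpha> ?A) \<le> 12 + 468 * card B"
    unfolding eq using A(2) card_Un_le[of "(\<lambda>k. power_mask M (\<alpha> k)) ` {..<12}" "?f ` ?I"] by linarith
qed

text \<open>Union bound over three kinds of failure: \<open>B\<close> too large, \<open>B\<close>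
  too small, or some nontrivial character sum too large.\<close>

lemma random_subset_good_prob:
  assumes M: "M > 0" and L: "2 \<le> ln (real M)" and p: "144 * ln (real M) / real M \<le> 1"
    and nz: "\<And>k. k < 12 \<Longrightarrow> \<alpha> k \<noteq> 0"
    and not_root: "\<And>k k'. k < 12 \<Longrightarrow> k' < 12 \<Longrightarrow> k \<noteq> k' \<Longrightarrow> (\<alpha> k * inverse (\<alpha> k')) ^ M \<noteq> 1"
  shows "1 - (exp (- 139 * ln (real M)) + exp (- 5 / 8 * ln (real M))
              + real M * (4 * exp (- 9 / 4 * ln (real M))))
    \<le> measure_pmf.prob (random_subset M (144 * ln (real M) / real M))
        {B. finite (masks M 12 \<alpha> (connection_set M B)) \<and>
            real (card (masks M 12 \<alpha> (connection_set M B))) \<le> 2 * 10 ^ 5 * ln (real M) \<and>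
            injective_intensities M (masks M 12 \<alpha> (connection_set M B))}"
    (is "1 - ?\<epsilon> \<le> measure_pmf.prob ?R ?G")
proof -
  let ?L = "ln (real M)"
  have p0: "0 \<le> 144 * ?L / real M" and mean: "144 * ?L / real M * real M = 144 * ?L"
    using L M by auto
  define H where "H = {B :: nat set. 427 * ?L \<le> real (card B)}"
  define J where "J = {B :: nat set. real (card B) \<le> 125 * ?L}"
  define N where "N j = {B. 51 * ?L < cmod (char_sum M B j)}" for j
  have good: "B \<in> ?G" if B: "B \<subseteq> {..<M}" "B \<notin> H" "B \<notin> J" "B \<notin> (\<Union>j\<in>{0<..<M}. N j)" for B
  proof -
    have fin: "finite B" using B(1) finite_subset by blast
    have "real (card (masks M 12 \<alpha> (connection_set M B))) \<le> 12 + 468 * real (card B)"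
      using masks_card(2)[OF fin, of M \<alpha>] by linarith
    \<comment> \<open>Since \<open>468 * 427 = 199836\<close>, the remaining
      \<open>164 * ln M\<close> absorbs the 12 single masks.\<close>
    also have "\<dots> \<le> 2 * 10 ^ 5 * ?L"
      using B(2) L by (simp add: H_def)
    finally have "real (card (masks M 12 \<alpha> (connection_set M B))) \<le> 2 * 10 ^ 5 * ?L" .
    moreover have "expanding M (B - {0})"
      using B by (intro expanding_if_char_sum[OF M fin L]) (auto simp: J_def N_def not_le not_less)
    then have "injective_intensities M (masks M 12 \<alpha> (connection_set M B))"
      by (intro injective_if_expanding M nz not_root B(1))
    ultimately show ?thesis
      using masks_card(1)[OF fin] by simp
  qed
  have "measure_pmf.prob ?R (- ?G) \<le> measure_pmf.prob ?R (H \<union> J \<union> (\<Union>j\<in>{0<..<M}. N j))"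
  proof (intro measure_pmf.finite_measure_mono_AE AE_pmfI impI)
    fix B assume "B \<in> set_pmf ?R" "B \<in> - ?G"
    then show "B \<in> H \<union> J \<union> (\<Union>j\<in>{0<..<M}. N j)"
      using good[OF random_subset_subset] by blast
  qed simp
  also have "\<dots> \<le> (measure_pmf.prob ?R H + measure_pmf.prob ?R J)
      + measure_pmf.prob ?R (\<Union>j\<in>{0<..<M}. N j)"
    by (rule order_trans[OF measure_Un_le add_right_mono[OF measure_Un_le]]) simp_all
  also have "\<dots> \<le> ?\<epsilon>"
  proof (intro add_mono)
    show "measure_pmf.prob ?R H \<le> exp (- 139 * ?L)"
      unfolding H_def by (rule real_card_random_subset_upper[OF p0 p mean])
    show "measure_pmf.prob ?R J \<le> exp (- 5 / 8 * ?L)"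
      unfolding J_def by (rule real_card_random_subset_lower[OF p0 p mean])
    have "measure_pmf.prob ?R (\<Union>j\<in>{0<..<M}. N j) \<le> (\<Sum>j\<in>{0<..<M}. measure_pmf.prob ?R (N j))"
      by (intro measure_pmf.finite_measure_subadditive_finite) auto
    also have "\<dots> \<le> (\<Sum>j\<in>{0<..<M}. 4 * exp (- 9 / 4 * ?L))"
      unfolding N_def using L by (intro sum_mono random_subset_char_sum[OF p0 p mean]) auto
    also have "\<dots> \<le> real M * (4 * exp (- 9 / 4 * ?L))"
      by simp
    finally show "measure_pmf.prob ?R (\<Union>j\<in>{0<..<M}. N j) \<le> real M * (4 * exp (- 9 / 4 * ?L))" .
  qed
  finally show ?thesis
    using measure_pmf.prob_compl[of ?G ?R] by (simp add: Compl_eq_Diff_UNIV)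
qed

text \<open>Finiteness is part of the event because \<open>card\<close> is 0 on infinite sets. The
  numbers \<open>\<alpha> M k\<close> may change with \<open>M\<close>.\<close>

theorem theorem10:
  fixes K :: nat and c :: real and M\<^sub>0 :: nat
    and \<alpha> :: "nat \<Rightarrow> nat \<Rightarrow> complex"
  assumes K: "K = 12" and c: "c = 144"
    and large: "\<And>M. M \<ge> M\<^sub>0 \<Longrightarrow> c * ln (real M) / real M \<le> 1"
    and nonzero: "\<And>M k. M \<ge> M\<^sub>0 \<Longrightarrow> M > 0 \<Longrightarrow> k < K \<Longrightarrow> \<alpha> M k \<noteq> 0"
    and not_root: "\<And>M k k'. M \<ge> M\<^sub>0 \<Longrightarrow> M > 0 \<Longrightarrow> k < K \<Longrightarrow> k' < K \<Longrightarrow> k \<noteq> k' \<Longrightarrow>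
                     (\<alpha> M k * inverse (\<alpha> M k')) ^ M \<noteq> 1"
  shows "(\<lambda>M. measure_pmf.prob (random_subset M (c * ln (real M) / real M))
            {B. finite (masks M K (\<alpha> M) (connection_set M B)) \<and>
                real (card (masks M K (\<alpha> M) (connection_set M B))) \<le> 2 * 10 ^ 5 * ln (real M) \<and>
                injective_intensities M (masks M K (\<alpha> M) (connection_set M B))})
         \<longlonglongrightarrow> 1"
proof (rule tendsto_sandwich)
  let ?\<epsilon> = "\<lambda>M. exp (- 139 * ln (real M)) + exp (- 5 / 8 * ln (real M))
              + real M * (4 * exp (- 9 / 4 * ln (real M)))"
  \<comment> \<open>The error is \<open>M^(-139) + M^(-5/8) + 4 * M^(-5/4)\<close>.\<close>
  show "(\<lambda>M. 1 - ?\<epsilon> M) \<longlonglongrightarrow> 1"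
    by real_asymp
  have "\<forall>\<^sub>F M :: nat in sequentially. 2 \<le> ln (real M)"
    by real_asymp
  then show "\<forall>\<^sub>F M in sequentially. 1 - ?\<epsilon> M \<le>
      measure_pmf.prob (random_subset M (c * ln (real M) / real M))
            {B. finite (masks M K (\<alpha> M) (connection_set M B)) \<and>
                real (card (masks M K (\<alpha> M) (connection_set M B))) \<le> 2 * 10 ^ 5 * ln (real M) \<and>
                injective_intensities M (masks M K (\<alpha> M) (connection_set M B))}"
    using eventually_ge_at_top[of M\<^sub>0] eventually_gt_at_top[of 0]
  proof eventually_elim
    case (elim M)
    then show ?case
      unfolding K c
      by (intro random_subset_good_prob)
        (use large[of M] nonzero[of M] not_root[of M] K c in auto)
  qed
qed (use measure_pmf.prob_le_1 in auto)

end
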